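(* Let $1\le p<\infty$, $1/p+1/q=1$, and let $X$ be a closed subspace of $L_p(\mathbb{R})$. Suppose either (i) $(f_i,g_i)_{i=1}^\infty\subseteq L_p(\mathbb{R})\times L_q(\mathbb{R})$ is a frame for $X$ satisfying condition $( * )$: for all $\varepsilon>0$ and all bounded intervals $I\subseteq\mathbb{R}$ there exists $n\in\mathbb{N}$ such that for all $m\ge n$ and all $f\in X$, $\big\|\sum_{i=m+1}^\infty\langle f,g_i\rangle f_i|_I\big\|_p\le\varepsilon\|f\|_p$; or (ii) $(f_i)_{i=1}^\infty$ is a semi-normalized bounded fundamental minimal system for $X$ satisfying condition $( ** )$: for all $\varepsilon>0$ and all bounded intervals $I\subseteq\mathbb{R}$ there exists $n\in\mathbb{N}$ such that for all $n<m\le m_1\le m_2$ and all $f=\sum_{i=1}^{m_2}a_if_i$ with $\|f\|_p=1$, one has $\big\|\sum_{i=m}^{m_1}a_if_i|_I\big\|_p\le\varepsilon$. Then $X$ embeds almost isometrically into $\ell_p$.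
   Context: A frame for $X$ is a sequence $(f_i,g_i)\subseteq X\times L_q(\mathbb{R})$ with $f=\sum_{i=1}^\infty\langle f,g_i\rangle f_i$ in norm for all $f\in X$, where $\langle f,g\rangle=\int fg$. A sequence $(f_i)$ is semi-normalized if $0<\inf\|f_i\|\le\sup\|f_i\|<\infty$; it is a bounded minimal system if there exist functionals $(f_i^* )\subseteq X^*$ with $f_i^*(f_j)=\delta_{ij}$ and $\sup_i\|f_i\|\|f_i^*\|<\infty$; fundamental means its closed linear span is $X$. $g|_I$ denotes restriction of $g$ to $I$. $X$ embeds almost isometrically into $\ell_p$ if for every $\varepsilon>0$ there is a linear $T:X\to\ell_p$ with $(1+\varepsilon)^{-1}\le\|Tf\|\le1+\varepsilon$ for all $f\in X$ with $\|f\|=1$. *)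

theory Defs
  imports "HOL-Analysis.Analysis"
begin

text \<open>Functions on the real line are represented by real-valued representatives;
  L_p quantities are computed w.r.t. Lebesgue measure (lborel).\<close>

definition Lp_mem :: "real \<Rightarrow> (real \<Rightarrow> real) \<Rightarrow> bool" where
  "Lp_mem p f \<longleftrightarrow> f \<in> borel_measurable lborel \<and> integrable lborel (\<lambda>x. \<bar>f x\<bar> powr p)"

definition Lp_norm :: "real \<Rightarrow> (real \<Rightarrow> real) \<Rightarrow> real" where
  "Lp_norm p f = (\<integral>x. \<bar>f x\<bar> powr p \<partial>lborel) powr (1 / p)"

definition Lq_mem :: "real \<Rightarrow> (real \<Rightarrow> real) \<Rightarrow> bool" where
  "Lq_mem p g \<longleftrightarrow> (if p = 1
      then g \<in> borel_measurable lborel \<and> (\<exists>C. AE x in lborel. \<bar>g x\<bar> \<le> C)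
      else Lp_mem (p / (p - 1)) g)"

definition pairing :: "(real \<Rightarrow> real) \<Rightarrow> (real \<Rightarrow> real) \<Rightarrow> real" where
  "pairing f g = (\<integral>x. f x * g x \<partial>lborel)"

definition restrict_to :: "(real \<Rightarrow> real) \<Rightarrow> real set \<Rightarrow> real \<Rightarrow> real" where
  "restrict_to g I = (\<lambda>x. indicator I x * g x)"

definition bounded_interval :: "real set \<Rightarrow> bool" where
  "bounded_interval I \<longleftrightarrow> is_interval I \<and> bounded I"

definition closed_Lp_subspace :: "real \<Rightarrow> (real \<Rightarrow> real) set \<Rightarrow> bool" where
  "closed_Lp_subspace p X \<longleftrightarrow>
     (\<forall>f\<in>X. Lp_mem p f) \<and> (\<lambda>x. 0) \<in> X \<and>
     (\<forall>f\<in>X. \<forall>g\<in>X. \<forall>a b. (\<lambda>x. a * f x + b * g x) \<in> X) \<and>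
     (\<forall>h f. (\<forall>n. h n \<in> X) \<longrightarrow> Lp_mem p f \<longrightarrow>
         (\<lambda>n. Lp_norm p (\<lambda>x. h n x - f x)) \<longlonglongrightarrow> 0 \<longrightarrow> f \<in> X)"

definition is_frame :: "real \<Rightarrow> (real \<Rightarrow> real) set \<Rightarrow> (nat \<Rightarrow> real \<Rightarrow> real) \<Rightarrow> (nat \<Rightarrow> real \<Rightarrow> real) \<Rightarrow> bool" where
  "is_frame p X F G \<longleftrightarrow> (\<forall>i. F i \<in> X \<and> Lq_mem p (G i)) \<and>
     (\<forall>f\<in>X. (\<lambda>n. Lp_norm p (\<lambda>x. f x - (\<Sum>i<n. pairing f (G i) * F i x))) \<longlonglongrightarrow> 0)"

text \<open>Condition (*). The tail sum_{i>m} <f,g_i> f_i is (in L_p) equal to f minus the partial sum.\<close>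
definition cond_star :: "real \<Rightarrow> (real \<Rightarrow> real) set \<Rightarrow> (nat \<Rightarrow> real \<Rightarrow> real) \<Rightarrow> (nat \<Rightarrow> real \<Rightarrow> real) \<Rightarrow> bool" where
  "cond_star p X F G \<longleftrightarrow> (\<forall>\<epsilon>>0. \<forall>I. bounded_interval I \<longrightarrow> (\<exists>n. \<forall>m\<ge>n. \<forall>f\<in>X.
     Lp_norm p (restrict_to (\<lambda>x. f x - (\<Sum>i<m. pairing f (G i) * F i x)) I) \<le> \<epsilon> * Lp_norm p f))"

definition semi_normalized :: "real \<Rightarrow> (nat \<Rightarrow> real \<Rightarrow> real) \<Rightarrow> bool" where
  "semi_normalized p F \<longleftrightarrow> (\<exists>c C. 0 < c \<and> (\<forall>i. c \<le> Lp_norm p (F i) \<and> Lp_norm p (F i) \<le> C))"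

definition bounded_minimal_system :: "real \<Rightarrow> (real \<Rightarrow> real) set \<Rightarrow> (nat \<Rightarrow> real \<Rightarrow> real) \<Rightarrow> bool" where
  "bounded_minimal_system p X F \<longleftrightarrow> (\<forall>i. F i \<in> X) \<and>
     (\<exists>\<phi> :: nat \<Rightarrow> (real \<Rightarrow> real) \<Rightarrow> real.
        (\<forall>i. \<forall>f\<in>X. \<forall>g\<in>X. \<forall>a b. \<phi> i (\<lambda>x. a * f x + b * g x) = a * \<phi> i f + b * \<phi> i g) \<and>
        (\<forall>i. \<exists>K. \<forall>f\<in>X. \<bar>\<phi> i f\<bar> \<le> K * Lp_norm p f) \<and>
        (\<forall>i j. \<phi> i (F j) = (if i = j then 1 else 0)) \<and>
        (\<exists>M. \<forall>i. \<forall>f\<in>X. Lp_norm p (F i) * \<bar>\<phi> i f\<bar> \<le> M * Lp_norm p f))"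

definition fundamental :: "real \<Rightarrow> (real \<Rightarrow> real) set \<Rightarrow> (nat \<Rightarrow> real \<Rightarrow> real) \<Rightarrow> bool" where
  "fundamental p X F \<longleftrightarrow> (\<forall>i. F i \<in> X) \<and>
     (\<forall>f\<in>X. \<forall>\<epsilon>>0. \<exists>n a. Lp_norm p (\<lambda>x. f x - (\<Sum>i<n. a i * F i x)) < \<epsilon>)"

text \<open>Condition (**), with 0-based indices (F k is the paper's f_{k+1}).\<close>
definition cond_star_star :: "real \<Rightarrow> (nat \<Rightarrow> real \<Rightarrow> real) \<Rightarrow> bool" where
  "cond_star_star p F \<longleftrightarrow> (\<forall>\<epsilon>>0. \<forall>I. bounded_interval I \<longrightarrow> (\<exists>n. \<forall>k m1 m2 a.
     n \<le> k \<and> k < m1 \<and> m1 \<le> m2 \<and> Lp_norm p (\<lambda>x. \<Sum>i<m2. a i * F i x) = 1 \<longrightarrow>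
     Lp_norm p (restrict_to (\<lambda>x. \<Sum>i\<in>{k..<m1}. a i * F i x) I) \<le> \<epsilon>))"

definition lp_seq_mem :: "real \<Rightarrow> (nat \<Rightarrow> real) \<Rightarrow> bool" where
  "lp_seq_mem p s \<longleftrightarrow> summable (\<lambda>n. \<bar>s n\<bar> powr p)"

definition lp_seq_norm :: "real \<Rightarrow> (nat \<Rightarrow> real) \<Rightarrow> real" where
  "lp_seq_norm p s = (\<Sum>n. \<bar>s n\<bar> powr p) powr (1 / p)"

definition embeds_almost_isometrically_lp :: "real \<Rightarrow> (real \<Rightarrow> real) set \<Rightarrow> bool" where
  "embeds_almost_isometrically_lp p X \<longleftrightarrow> (\<forall>\<epsilon>>0. \<exists>T :: (real \<Rightarrow> real) \<Rightarrow> (nat \<Rightarrow> real).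
     (\<forall>f\<in>X. lp_seq_mem p (T f)) \<and>
     (\<forall>f\<in>X. \<forall>g\<in>X. \<forall>a b. T (\<lambda>x. a * f x + b * g x) = (\<lambda>n. a * T f n + b * T g n)) \<and>
     (\<forall>f\<in>X. Lp_norm p f = 1 \<longrightarrow>
        inverse (1 + \<epsilon>) \<le> lp_seq_norm p (T f) \<and> lp_seq_norm p (T f) \<le> 1 + \<epsilon>))"

end

theory Submission
  imports Defs
begin

text \<open>Either hypothesis says that on each unit interval \<open>I\<close> the unit sphere of \<open>X\<close> is, up to any
  prescribed error, contained in the set of combinations of finitely many \<open>F i\<close> with bounded
  coefficients; in case (ii) this uses norm-one finite combinations close to \<open>f\<close>, whose
  coefficients the biorthogonal functionals bound. Partition \<open>I\<close> into countably many measurable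
  cells on which these \<open>F i\<close> oscillate very little. Replacing \<open>f\<close> by its averages over the cells
  is an L_p contraction that almost fixes the \<open>F i\<close> in question, hence moves \<open>f\<close> by at most a
  small error on \<open>I\<close>. With errors summable over the unit intervals, the averaged function is
  globally close to \<open>f\<close>, and functions constant on the cells form a copy of a subspace of
  the sequence space.\<close>

section \<open>The L_p norm\<close>

text \<open>The graph of a convex function lies above its tangent at \<open>c\<close>. Convexity is
  used on the open half line, so the boundary point \<open>x = 0\<close> is separate; there the
  claim reduces to \<open>(1 - p) * c powr p \<le> 0\<close>.\<close>

lemma powr_above_tangent:
  fixes p c x :: real
  assumes "1 \<le> p" "0 < c" "0 \<le> x"
  shows "c powr p + p * c powr (p - 1) * (x - c) \<le> x powr p"
proof (cases "x = 0")
  case True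
  have "c powr (p - 1) * c = c powr p"
    using assms by (simp add: powr_diff)
  then have "c powr p + p * c powr (p - 1) * (x - c) = (1 - p) * c powr p"
    using True by (simp add: algebra_simps)
  also have "\<dots> \<le> 0"
    using assms by (simp add: mult_nonpos_nonneg)
  finally show ?thesis using True by simp
next
  case False
  then have "x powr p - c powr p \<ge> (p * c powr (p - 1)) * (x - c)"
    using assms
    by (intro convex_on_imp_above_tangent[of "{0<..}"] powr_convex)
       (auto simp: interior_open intro!: derivative_eq_intros)
  then show ?thesis by simp
qed

text \<open>Take the tangent inequalities at the combined point \<open>c\<close>, once at
  \<open>a\<close> and once at \<open>b\<close>, with weights \<open>t\<close> and
  \<open>1 - t\<close>: the linear terms cancel and \<open>c powr p\<close> remains. If
  \<open>c\<close> vanishes, the left side is \<open>0\<close>.\<close>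

lemma powr_convex_comb:
  fixes p a b t :: real
  assumes "1 \<le> p" "0 \<le> a" "0 \<le> b" "0 \<le> t" "t \<le> 1"
  shows "(t * a + (1 - t) * b) powr p \<le> t * a powr p + (1 - t) * b powr p"
proof (cases "t * a + (1 - t) * b = 0")
  case True
  then show ?thesis using assms by simp
next
  case False
  define c where "c = t * a + (1 - t) * b"
  have c: "0 < c"
    using False assms unfolding c_def by (simp add: order_less_le)
  have "t * (c powr p + p * c powr (p - 1) * (a - c)) + (1 - t) * (c powr p + p * c powr (p - 1) * (b - c))
      \<le> t * a powr p + (1 - t) * b powr p"
    using assms c by (intro add_mono mult_left_mono powr_above_tangent) auto
  also have "t * (c powr p + p * c powr (p - 1) * (a - c)) + (1 - t) * (c powr p + p * c powr (p - 1) * (b - c))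
      = c powr p + p * c powr (p - 1) * (t * a + (1 - t) * b - c)"
    by (simp add: algebra_simps)
  finally show ?thesis by (simp add: c_def)
qed

text \<open>Each summand is at most the maximum \<open>m\<close>, and \<open>m powr p\<close> is one
  of the three terms on the right. The constant is not sharp; it is later divided out when error
  budgets are chosen.\<close>

lemma powr_add3_le:
  fixes p a b c :: real
  assumes "0 \<le> p" "0 \<le> a" "0 \<le> b" "0 \<le> c"
  shows "(a + b + c) powr p \<le> 3 powr p * (a powr p + b powr p + c powr p)"
proof -
  define m where "m = max a (max b c)"
  have "(a + b + c) powr p \<le> (3 * m) powr p"
    using assms by (intro powr_mono2) (auto simp: m_def)
  also have "\<dots> = 3 powr p * m powr p"
    using assms by (simp add: powr_mult m_def)
  also have "m powr p \<le> a powr p + b powr p + c powr p"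
    by (auto simp: m_def max_def)
  finally show ?thesis by (simp add: mult_left_mono)
qed

section \<open>Membership in L_p\<close>

lemma Lp_memD:
  assumes "Lp_mem p f"
  shows "f \<in> borel_measurable borel" "integrable lborel (\<lambda>x. \<bar>f x\<bar> powr p)"
  using assms by (auto simp: Lp_mem_def)

lemma Lp_mem_iff_nn_integral:
  "Lp_mem p f \<longleftrightarrow> f \<in> borel_measurable borel \<and> (\<integral>\<^sup>+x. ennreal (\<bar>f x\<bar> powr p) \<partial>lborel) < \<infinity>"
proof -
  have "(\<lambda>x. \<bar>f x\<bar> powr p) \<in> borel_measurable borel" if [measurable]: "f \<in> borel_measurable borel"
    by measurable
  then show ?thesis
    unfolding Lp_mem_def by (auto simp: integrable_iff_bounded)
qed

lemma Lp_mem_bound: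
  assumes "Lp_mem p f" "g \<in> borel_measurable borel" "\<And>x. \<bar>g x\<bar> \<le> \<bar>f x\<bar>" "0 \<le> p"
  shows "Lp_mem p g"
proof -
  note [measurable] = assms(2)
  have "norm (\<bar>g x\<bar> powr p) \<le> norm (\<bar>f x\<bar> powr p)" for x
    using powr_mono2[OF assms(4) _ assms(3)[of x]] by simp
  then have "integrable lborel (\<lambda>x. \<bar>g x\<bar> powr p)"
    by (intro Bochner_Integration.integrable_bound[OF Lp_memD(2)[OF assms(1)]] AE_I2) measurable
  then show ?thesis using assms(2) by (simp add: Lp_mem_def)
qed

lemma Lp_mem_scale:
  assumes "Lp_mem p f"
  shows "Lp_mem p (\<lambda>x. a * f x)"
  using assms by (auto simp: Lp_mem_def abs_mult powr_mult)

lemma Lp_mem_add: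
  assumes "Lp_mem p f" "Lp_mem p g" "0 \<le> p"
  shows "Lp_mem p (\<lambda>x. f x + g x)"
proof -
  note [measurable] = Lp_memD(1)[OF assms(1)] Lp_memD(1)[OF assms(2)]
  \<comment> \<open>The third summand \<open>0 powr p\<close> is zero; it keeps the dominating
    function in the shape of the three-term inequality.\<close>
  have int: "integrable lborel (\<lambda>x. 3 powr p * (\<bar>f x\<bar> powr p + \<bar>g x\<bar> powr p + 0 powr p))"
    using assms by (simp add: Lp_memD)
  have "\<bar>f x + g x\<bar> powr p \<le> 3 powr p * (\<bar>f x\<bar> powr p + \<bar>g x\<bar> powr p + 0 powr p)" for x
  proof -
    have "\<bar>f x + g x\<bar> powr p \<le> (\<bar>f x\<bar> + \<bar>g x\<bar> + 0) powr p"
      using assms(3) by (intro powr_mono2) auto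
    also have "\<dots> \<le> 3 powr p * (\<bar>f x\<bar> powr p + \<bar>g x\<bar> powr p + 0 powr p)"
      using assms(3) by (intro powr_add3_le) auto
    finally show ?thesis .
  qed
  then have "integrable lborel (\<lambda>x. \<bar>f x + g x\<bar> powr p)"
    by (intro Bochner_Integration.integrable_bound[OF int] AE_I2) auto
  then show ?thesis by (simp add: Lp_mem_def)
qed

lemma Lp_mem_diff:
  assumes "Lp_mem p f" "Lp_mem p g" "0 \<le> p"
  shows "Lp_mem p (\<lambda>x. f x - g x)"
  using Lp_mem_add[OF assms(1) Lp_mem_scale[OF assms(2), of "-1"] assms(3)] by simp

lemma Lp_mem_sum:
  assumes "\<And>i. i \<in> A \<Longrightarrow> Lp_mem p (F i)" "0 \<le> p"
  shows "Lp_mem p (\<lambda>x. \<Sum>i\<in>A. c i * F i x)"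
  using assms(1)
proof (induction A rule: infinite_finite_induct)
  case (insert i A)
  then show ?case
    using Lp_mem_add[OF Lp_mem_scale[of p "F i" "c i"], of "\<lambda>x. \<Sum>i\<in>A. c i * F i x"] assms(2) by simp
qed (auto simp: Lp_mem_def)

lemma restrict_to_measurable:
  assumes "f \<in> borel_measurable borel" "I \<in> sets borel"
  shows "restrict_to f I \<in> borel_measurable borel"
  using assms unfolding restrict_to_def by measurable

lemma Lp_mem_restrict_to:
  assumes "Lp_mem p f" "I \<in> sets borel" "0 \<le> p"
  shows "Lp_mem p (restrict_to f I)"
proof (rule Lp_mem_bound[OF assms(1)])
  show "restrict_to f I \<in> borel_measurable borel"
    using assms by (intro restrict_to_measurable Lp_memD(1))
qed (use assms in \<open>auto simp: restrict_to_def indicator_def\<close>)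

section \<open>The norm and Minkowski's inequality\<close>

lemma Lp_norm_nonneg: "0 \<le> Lp_norm p f"
  by (simp add: Lp_norm_def)

lemma Lp_norm_powr:
  assumes "1 \<le> p"
  shows "Lp_norm p f powr p = (\<integral>x. \<bar>f x\<bar> powr p \<partial>lborel)"
  using assms by (simp add: Lp_norm_def powr_powr)

text \<open>Moves every norm estimate to the integral of the p-th power, where errors on disjoint
  sets add up.\<close>

lemma Lp_norm_le_iff:
  assumes "1 \<le> p" "0 \<le> c"
  shows "Lp_norm p f \<le> c \<longleftrightarrow> (\<integral>x. \<bar>f x\<bar> powr p \<partial>lborel) \<le> c powr p"
proof
  assume "Lp_norm p f \<le> c"
  then have "Lp_norm p f powr p \<le> c powr p"
    using assms by (intro powr_mono2) (auto simp: Lp_norm_nonneg)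
  then show "(\<integral>x. \<bar>f x\<bar> powr p \<partial>lborel) \<le> c powr p"
    using assms by (simp add: Lp_norm_powr)
next
  assume "(\<integral>x. \<bar>f x\<bar> powr p \<partial>lborel) \<le> c powr p"
  then have "Lp_norm p f \<le> (c powr p) powr (1 / p)"
    unfolding Lp_norm_def using assms by (intro powr_mono2) auto
  then show "Lp_norm p f \<le> c"
    using assms by (simp add: powr_powr)
qed

lemma Lp_norm_eq_1_iff:
  assumes "1 \<le> p"
  shows "Lp_norm p f = 1 \<longleftrightarrow> (\<integral>x. \<bar>f x\<bar> powr p \<partial>lborel) = 1"
proof
  assume "Lp_norm p f = 1"
  with Lp_norm_powr[OF assms, of f] show "(\<integral>x. \<bar>f x\<bar> powr p \<partial>lborel) = 1"
    by simp
qed (simp add: Lp_norm_def)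

lemma nn_integral_powr_eq:
  assumes "Lp_mem p f"
  shows "(\<integral>\<^sup>+x. ennreal (\<bar>f x\<bar> powr p) \<partial>lborel) = ennreal (\<integral>x. \<bar>f x\<bar> powr p \<partial>lborel)"
  using assms by (intro nn_integral_eq_integral) (auto simp: Lp_mem_def)

lemma Lp_norm_scale:
  assumes "1 \<le> p"
  shows "Lp_norm p (\<lambda>x. a * f x) = \<bar>a\<bar> * Lp_norm p f"
  using assms by (simp add: Lp_norm_def abs_mult powr_mult powr_powr)

lemma Lp_norm_minus_commute: "Lp_norm p (\<lambda>x. f x - g x) = Lp_norm p (\<lambda>x. g x - f x)"
  by (simp add: Lp_norm_def abs_minus_commute)

text \<open>Up to the factor \<open>A + B\<close>, the sum \<open>f + g\<close> is the convex
  combination of \<open>f / A\<close> and \<open>g / B\<close> with weight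
  \<open>t = A / (A + B)\<close>. Convexity of the power applies pointwise, and after integration
  both normalized terms are at most \<open>1\<close>.\<close>

lemma Lp_norm_triangle:
  assumes p: "1 \<le> p" and f: "Lp_mem p f" and g: "Lp_mem p g"
  shows "Lp_norm p (\<lambda>x. f x + g x) \<le> Lp_norm p f + Lp_norm p g"
proof (rule field_le_epsilon)
  fix e :: real assume e: "0 < e"
  \<comment> \<open>The slack \<open>e / 2\<close> keeps both divisors positive even when a norm is
    zero.\<close>
  define A where "A = Lp_norm p f + e / 2"
  define B where "B = Lp_norm p g + e / 2"
  have A: "0 < A" and B: "0 < B"
    using e by (simp_all add: A_def B_def Lp_norm_nonneg add_nonneg_pos)
  have fg: "Lp_mem p (\<lambda>x. f x + g x)"
    using Lp_mem_add f g p by simp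
  define t where "t = A / (A + B)"
  have t: "0 \<le> t" "t \<le> 1" "1 - t = B / (A + B)"
    using A B by (auto simp: t_def field_simps)
  have fA: "(\<integral>x. \<bar>f x\<bar> powr p \<partial>lborel) \<le> A powr p"
    using Lp_norm_le_iff[OF p, of A f] A e by (simp add: A_def)
  have gB: "(\<integral>x. \<bar>g x\<bar> powr p \<partial>lborel) \<le> B powr p"
    using Lp_norm_le_iff[OF p, of B g] B e by (simp add: B_def)
  have pt: "\<bar>f x + g x\<bar> powr p \<le> (A + B) powr p * (t * (\<bar>f x\<bar> powr p / A powr p) + (1 - t) * (\<bar>g x\<bar> powr p / B powr p))" for x
  proof -
    have "\<bar>f x + g x\<bar> powr p \<le> (\<bar>f x\<bar> + \<bar>g x\<bar>) powr p"
      using p by (intro powr_mono2) auto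
    also have "\<bar>f x\<bar> + \<bar>g x\<bar> = ((A + B) * t) * (\<bar>f x\<bar> / A) + ((A + B) * (1 - t)) * (\<bar>g x\<bar> / B)"
      unfolding t(3) using A B by (simp add: t_def)
    also have "\<dots> = (A + B) * (t * (\<bar>f x\<bar> / A) + (1 - t) * (\<bar>g x\<bar> / B))"
      by (simp only: distrib_left mult.assoc)
    also have "\<dots> powr p = (A + B) powr p * (t * (\<bar>f x\<bar> / A) + (1 - t) * (\<bar>g x\<bar> / B)) powr p"
      using A B t by (simp add: powr_mult)
    also have "\<dots> \<le> (A + B) powr p * (t * (\<bar>f x\<bar> / A) powr p + (1 - t) * (\<bar>g x\<bar> / B) powr p)"
      using A B t p by (intro mult_left_mono powr_convex_comb) auto
    finally show ?thesis using A B by (simp add: powr_divide)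
  qed
  have "(\<integral>x. \<bar>f x + g x\<bar> powr p \<partial>lborel)
      \<le> (\<integral>x. (A + B) powr p * (t * (\<bar>f x\<bar> powr p / A powr p) + (1 - t) * (\<bar>g x\<bar> powr p / B powr p)) \<partial>lborel)"
    using pt Lp_memD(2)[OF fg] Lp_memD(2)[OF f] Lp_memD(2)[OF g] by (intro integral_mono) auto
  also have "\<dots> = (A + B) powr p * (t * ((\<integral>x. \<bar>f x\<bar> powr p \<partial>lborel) / A powr p)
      + (1 - t) * ((\<integral>x. \<bar>g x\<bar> powr p \<partial>lborel) / B powr p))"
    using Lp_memD(2)[OF f] Lp_memD(2)[OF g] by simp
  also have "\<dots> \<le> (A + B) powr p * (t * 1 + (1 - t) * 1)"
    using t fA gB A B by (intro mult_left_mono add_mono) auto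
  finally have "Lp_norm p (\<lambda>x. f x + g x) \<le> A + B"
    using Lp_norm_le_iff[OF p] A B by simp
  then show "Lp_norm p (\<lambda>x. f x + g x) \<le> Lp_norm p f + Lp_norm p g + e"
    by (simp add: A_def B_def)
qed

lemma Lp_norm_diff_bound:
  assumes p: "1 \<le> p" and f: "Lp_mem p f" and g: "Lp_mem p g"
  shows "\<bar>Lp_norm p f - Lp_norm p g\<bar> \<le> Lp_norm p (\<lambda>x. f x - g x)"
proof -
  have "Lp_mem p (\<lambda>x. f x - g x)" "Lp_mem p (\<lambda>x. g x - f x)"
    using Lp_mem_diff f g p by simp_all
  from Lp_norm_triangle[OF p g this(1)] Lp_norm_triangle[OF p f this(2)] show ?thesis
    by (simp add: Lp_norm_minus_commute[of p g f])
qed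

section \<open>Averaging over a countable partition\<close>

text \<open>By the junk value \<open>x / 0 = 0\<close>, the average over a null cell is \<open>0\<close>.\<close>

definition cell_avg :: "(real \<Rightarrow> nat) \<Rightarrow> (real \<Rightarrow> real) \<Rightarrow> nat \<Rightarrow> real" where
  "cell_avg \<kappa> f n = (\<integral>x. restrict_to f (\<kappa> -` {n}) x \<partial>lborel) / measure lborel (\<kappa> -` {n})"

text \<open>This is the conditional expectation of \<open>f\<close> given the \<sigma>-algebra
  generated by the cells, up to null cells.\<close>

definition cell_exp :: "(real \<Rightarrow> nat) \<Rightarrow> (real \<Rightarrow> real) \<Rightarrow> real \<Rightarrow> real" where
  "cell_exp \<kappa> f x = cell_avg \<kappa> f (\<kappa> x)"

text \<open>The weight is the L_p norm of the indicator of the cell, so that the sequence norm of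
  the coordinates equals the L_p norm of \<open>cell_exp\<close>.\<close>

definition cell_coords :: "real \<Rightarrow> (real \<Rightarrow> nat) \<Rightarrow> (real \<Rightarrow> real) \<Rightarrow> nat \<Rightarrow> real" where
  "cell_coords p \<kappa> f n = measure lborel (\<kappa> -` {n}) powr (1 / p) * cell_avg \<kappa> f n"

lemma nn_integral_vimage_sums:
  fixes \<iota> :: "real \<Rightarrow> nat"
  assumes "g \<in> borel_measurable borel" and "\<And>n. \<iota> -` {n} \<in> sets borel"
  shows "(\<integral>\<^sup>+x. g x \<partial>lborel) = (\<Sum>n. \<integral>\<^sup>+x. g x * indicator (\<iota> -` {n}) x \<partial>lborel)"
proof -
  note [measurable] = assms
  \<comment> \<open>At each \<open>x\<close> only the term with \<open>n = \<iota> x\<close>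
    survives.\<close>
  have "g x = (\<Sum>n. g x * indicator (\<iota> -` {n}) x)" for x
    by (subst suminf_cmult_indicator[of _ x "\<iota> x" "\<lambda>_. g x"]) (auto simp: disjoint_family_on_def)
  then have "(\<integral>\<^sup>+x. g x \<partial>lborel) = (\<integral>\<^sup>+x. (\<Sum>n. g x * indicator (\<iota> -` {n}) x) \<partial>lborel)"
    by presburger
  also have "\<dots> = (\<Sum>n. \<integral>\<^sup>+x. g x * indicator (\<iota> -` {n}) x \<partial>lborel)"
    by (intro nn_integral_suminf) measurable
  finally show ?thesis .
qed

text \<open>The partition is encoded by a labelling whose fibres are the cells: disjointness and
  covering are automatic, countability comes from the label type, and empty cells are
  allowed.\<close>

locale cell_partition =
  fixes \<kappa> :: "real \<Rightarrow> nat"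
  assumes cell_measurable: "\<kappa> \<in> borel \<rightarrow>\<^sub>M count_space UNIV"
    and cell_finite: "\<And>n. emeasure lborel (\<kappa> -` {n}) < \<infinity>"
begin

section \<open>Averages over a single cell\<close>

lemma cell_sets [measurable]: "\<kappa> -` {n} \<in> sets borel"
  using measurable_sets[OF cell_measurable, of "{n}"] by simp

text \<open>Since \<open>p \<ge> 1\<close>, the function is dominated on the cell by
  \<open>1 + \<bar>f x\<bar> powr p\<close>, which is integrable there because the cell has finite
  measure.\<close>

lemma integrable_on_cell:
  assumes p: "1 \<le> p" and f: "Lp_mem p f"
  shows "integrable lborel (restrict_to f (\<kappa> -` {n}))"
proof -
  note [measurable] = Lp_memD(1)[OF f]
  have int: "integrable lborel (\<lambda>x. indicator (\<kappa> -` {n}) x + \<bar>f x\<bar> powr p)"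
    using Lp_memD(2)[OF f] cell_finite by (intro Bochner_Integration.integrable_add) auto
  have "\<bar>f x\<bar> \<le> 1 + \<bar>f x\<bar> powr p" for x
  proof (cases "\<bar>f x\<bar> \<le> 1")
    case False
    then have "\<bar>f x\<bar> powr 1 \<le> \<bar>f x\<bar> powr p"
      using p by (intro powr_mono) auto
    then show ?thesis using False by simp
  qed (simp add: add_increasing2)
  then show ?thesis
    using restrict_to_measurable[OF Lp_memD(1)[OF f] cell_sets]
    by (intro Bochner_Integration.integrable_bound[OF int] AE_I2)
       (auto simp: restrict_to_def[abs_def] indicator_def split: if_splits)
qed

lemma cell_avg_linear:
  assumes p: "1 \<le> p" and "Lp_mem p f" "Lp_mem p g"
  shows "cell_avg \<kappa> (\<lambda>x. a * f x + b * g x) n = a * cell_avg \<kappa> f n + b * cell_avg \<kappa> g n"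
proof -
  have "restrict_to (\<lambda>x. a * f x + b * g x) (\<kappa> -` {n})
      = (\<lambda>x. a * restrict_to f (\<kappa> -` {n}) x + b * restrict_to g (\<kappa> -` {n}) x)"
    by (auto simp: restrict_to_def algebra_simps)
  then show ?thesis
    using integrable_on_cell[OF p] assms by (simp add: cell_avg_def add_divide_distrib)
qed

lemma cell_avg_sum:
  assumes p: "1 \<le> p" and "\<And>i. i \<in> A \<Longrightarrow> Lp_mem p (F i)"
  shows "cell_avg \<kappa> (\<lambda>x. \<Sum>i\<in>A. c i * F i x) n = (\<Sum>i\<in>A. c i * cell_avg \<kappa> (F i) n)"
  using assms(2)
proof (induction A rule: infinite_finite_induct)
  case (insert i A)
  have "Lp_mem p (\<lambda>x. \<Sum>i\<in>A. c i * F i x)"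
    using insert p by (intro Lp_mem_sum) auto
  then show ?case
    using insert cell_avg_linear[OF p, of "F i" "\<lambda>x. \<Sum>i\<in>A. c i * F i x" "c i" 1 n] by simp
qed (auto simp: cell_avg_def restrict_to_def)

text \<open>Jensen's inequality on one cell, obtained by integrating the tangent inequality at the
  mean \<open>c\<close> of \<open>\<bar>f\<bar>\<close>. When \<open>c\<close> or the measure
  \<open>w\<close> vanishes, so does the left side.\<close>

lemma cell_avg_powr_le:
  assumes p: "1 \<le> p" and f: "Lp_mem p f"
  shows "measure lborel (\<kappa> -` {n}) * \<bar>cell_avg \<kappa> f n\<bar> powr p
    \<le> (\<integral>x. \<bar>restrict_to f (\<kappa> -` {n}) x\<bar> powr p \<partial>lborel)"
proof -
  define w where "w = measure lborel (\<kappa> -` {n})"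
  define h where "h = restrict_to f (\<kappa> -` {n})"
  define c where "c = (\<integral>x. \<bar>h x\<bar> \<partial>lborel) / w"
  have h: "integrable lborel h" "Lp_mem p h"
    using integrable_on_cell[OF p f] Lp_mem_restrict_to[OF f] p by (auto simp: h_def)
  have "\<bar>integral\<^sup>L lborel h\<bar> \<le> (\<integral>x. \<bar>h x\<bar> \<partial>lborel)"
    using integral_norm_bound[of lborel h] by simp
  then have avg: "\<bar>cell_avg \<kappa> f n\<bar> \<le> c"
    by (simp add: cell_avg_def c_def h_def w_def divide_right_mono)
  show ?thesis
  proof (cases "c > 0 \<and> w > 0")
    case False
    then have "c \<le> 0 \<or> w = 0" by (auto simp: w_def not_less measure_le_0_iff)
    then have "w * \<bar>cell_avg \<kappa> f n\<bar> powr p = 0" using avg by auto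
    moreover have "0 \<le> (\<integral>x. \<bar>restrict_to f (\<kappa> -` {n}) x\<bar> powr p \<partial>lborel)"
      by simp
    ultimately show ?thesis unfolding w_def by linarith
  next
    case True
    have int: "integrable lborel (\<lambda>x. (c powr p - p * c powr (p - 1) * c) * indicator (\<kappa> -` {n}) x
        + p * c powr (p - 1) * \<bar>h x\<bar>)"
      using h cell_finite by (intro Bochner_Integration.integrable_add integrable_mult_right) auto
    have "w * \<bar>cell_avg \<kappa> f n\<bar> powr p \<le> w * c powr p"
      using avg p True by (intro mult_left_mono powr_mono2) auto
    \<comment> \<open>By the choice of \<open>c\<close>, the integral of
      \<open>\<bar>h\<bar>\<close> is \<open>c * w\<close>, so the two first-order terms
      cancel.\<close>
    also have "\<dots> = (c powr p - p * c powr (p - 1) * c) * w + p * c powr (p - 1) * (\<integral>x. \<bar>h x\<bar> \<partial>lborel)"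
      using True by (simp add: c_def field_simps)
    also have "\<dots> = (\<integral>x. (c powr p - p * c powr (p - 1) * c) * indicator (\<kappa> -` {n}) x
        + p * c powr (p - 1) * \<bar>h x\<bar> \<partial>lborel)"
      using h cell_finite by (subst Bochner_Integration.integral_add) (auto simp: w_def)
    also have "\<dots> \<le> (\<integral>x. \<bar>h x\<bar> powr p \<partial>lborel)"
    proof (rule integral_mono[OF int Lp_memD(2)[OF h(2)]])
      fix x
      show "(c powr p - p * c powr (p - 1) * c) * indicator (\<kappa> -` {n}) x + p * c powr (p - 1) * \<bar>h x\<bar>
          \<le> \<bar>h x\<bar> powr p"
        using powr_above_tangent[OF p, of c "\<bar>h x\<bar>"] True
        by (cases "\<kappa> x = n") (auto simp: h_def restrict_to_def algebra_simps)
    qed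
    finally show ?thesis by (simp add: w_def h_def)
  qed
qed

section \<open>Averaging as an L_p contraction\<close>

lemma cell_exp_measurable [measurable]: "cell_exp \<kappa> f \<in> borel_measurable borel"
  unfolding cell_exp_def using cell_measurable by (rule measurable_compose) simp

text \<open>The averaged function is constant on each cell. The extended integral makes the identity
  available before integrability or summability is known.\<close>

lemma nn_integral_cell_exp:
  "(\<integral>\<^sup>+x. ennreal (\<bar>cell_exp \<kappa> f x\<bar> powr p) \<partial>lborel)
    = (\<Sum>n. ennreal (measure lborel (\<kappa> -` {n}) * \<bar>cell_avg \<kappa> f n\<bar> powr p))"
proof -
  have "(\<integral>\<^sup>+x. ennreal (\<bar>cell_exp \<kappa> f x\<bar> powr p) * indicator (\<kappa> -` {n}) x \<partial>lborel)
      = ennreal (measure lborel (\<kappa> -` {n}) * \<bar>cell_avg \<kappa> f n\<bar> powr p)" for n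
  proof -
    have "(\<integral>\<^sup>+x. ennreal (\<bar>cell_exp \<kappa> f x\<bar> powr p) * indicator (\<kappa> -` {n}) x \<partial>lborel)
        = (\<integral>\<^sup>+x. ennreal (\<bar>cell_avg \<kappa> f n\<bar> powr p) * indicator (\<kappa> -` {n}) x \<partial>lborel)"
      by (intro nn_integral_cong) (auto simp: cell_exp_def indicator_def)
    also have "\<dots> = ennreal (\<bar>cell_avg \<kappa> f n\<bar> powr p) * emeasure lborel (\<kappa> -` {n})"
      by (simp add: nn_integral_cmult)
    also have "emeasure lborel (\<kappa> -` {n}) = ennreal (measure lborel (\<kappa> -` {n}))"
      using cell_finite by (intro emeasure_eq_ennreal_measure) (auto simp: less_top)
    finally show ?thesis by (simp add: ennreal_mult' mult.commute)
  qed
  then show ?thesis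
    by (subst nn_integral_vimage_sums[where \<iota> = \<kappa>]) auto
qed

text \<open>Both sides split into sums over the cells, and Jensen's inequality compares them term by
  term.\<close>

lemma cell_exp_contraction:
  assumes p: "1 \<le> p" and f: "Lp_mem p f"
  shows "(\<integral>\<^sup>+x. ennreal (\<bar>cell_exp \<kappa> f x\<bar> powr p) \<partial>lborel) \<le> (\<integral>\<^sup>+x. ennreal (\<bar>f x\<bar> powr p) \<partial>lborel)"
proof -
  note [measurable] = Lp_memD(1)[OF f]
  have "ennreal (measure lborel (\<kappa> -` {n}) * \<bar>cell_avg \<kappa> f n\<bar> powr p)
      \<le> (\<integral>\<^sup>+x. ennreal (\<bar>f x\<bar> powr p) * indicator (\<kappa> -` {n}) x \<partial>lborel)" for n
  proof -
    have "ennreal (measure lborel (\<kappa> -` {n}) * \<bar>cell_avg \<kappa> f n\<bar> powr p)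
        \<le> ennreal (\<integral>x. \<bar>restrict_to f (\<kappa> -` {n}) x\<bar> powr p \<partial>lborel)"
      by (rule ennreal_leI[OF cell_avg_powr_le[OF p f]])
    also have "\<dots> = (\<integral>\<^sup>+x. ennreal (\<bar>restrict_to f (\<kappa> -` {n}) x\<bar> powr p) \<partial>lborel)"
      using Lp_mem_restrict_to[OF f] p by (intro nn_integral_powr_eq[symmetric]) auto
    also have "\<dots> = (\<integral>\<^sup>+x. ennreal (\<bar>f x\<bar> powr p) * indicator (\<kappa> -` {n}) x \<partial>lborel)"
      by (intro nn_integral_cong) (auto simp: restrict_to_def indicator_def)
    finally show ?thesis .
  qed
  then show ?thesis
    unfolding nn_integral_cell_exp
    by (subst nn_integral_vimage_sums[where \<iota> = \<kappa> and g = "\<lambda>x. ennreal (\<bar>f x\<bar> powr p)"])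
       (auto intro!: suminf_le)
qed

lemma cell_exp_Lp_mem:
  assumes "1 \<le> p" "Lp_mem p f"
  shows "Lp_mem p (cell_exp \<kappa> f)"
  using cell_exp_contraction[OF assms] assms(2)
  by (auto simp: Lp_mem_iff_nn_integral intro: order.strict_trans1)

lemma cell_coords_powr:
  assumes "1 \<le> p"
  shows "\<bar>cell_coords p \<kappa> f n\<bar> powr p = measure lborel (\<kappa> -` {n}) * \<bar>cell_avg \<kappa> f n\<bar> powr p"
  using assms by (simp add: cell_coords_def abs_mult powr_mult powr_powr)

text \<open>The p-th powers of both norms are given by the same series over the cells. Its value is
  the integral of an L_p function, hence finite, which gives summability and allows the passage from
  extended to real sums.\<close>

lemma
  assumes p: "1 \<le> p" and f: "Lp_mem p f"
  shows cell_coords_mem: "lp_seq_mem p (cell_coords p \<kappa> f)"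
    and cell_coords_norm: "lp_seq_norm p (cell_coords p \<kappa> f) = Lp_norm p (cell_exp \<kappa> f)"
proof -
  have eq: "ennreal (\<integral>x. \<bar>cell_exp \<kappa> f x\<bar> powr p \<partial>lborel) = (\<Sum>n. ennreal (\<bar>cell_coords p \<kappa> f n\<bar> powr p))"
    using nn_integral_cell_exp[of f p] nn_integral_powr_eq[OF cell_exp_Lp_mem[OF p f]]
    by (simp add: cell_coords_powr[OF p])
  have sm: "summable (\<lambda>n. \<bar>cell_coords p \<kappa> f n\<bar> powr p)"
    using eq by (intro summable_suminf_not_top) (auto simp flip: eq)
  then show "lp_seq_mem p (cell_coords p \<kappa> f)"
    by (simp add: lp_seq_mem_def)
  have "ennreal (\<integral>x. \<bar>cell_exp \<kappa> f x\<bar> powr p \<partial>lborel) = ennreal (\<Sum>n. \<bar>cell_coords p \<kappa> f n\<bar> powr p)"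
    unfolding eq using sm by (intro suminf_ennreal2) auto
  then have "(\<integral>x. \<bar>cell_exp \<kappa> f x\<bar> powr p \<partial>lborel) = (\<Sum>n. \<bar>cell_coords p \<kappa> f n\<bar> powr p)"
    using sm by (subst (asm) ennreal_inj) (auto intro: suminf_nonneg)
  then show "lp_seq_norm p (cell_coords p \<kappa> f) = Lp_norm p (cell_exp \<kappa> f)"
    by (simp add: lp_seq_norm_def Lp_norm_def)
qed

end

section \<open>Local error of the averaging\<close>

context cell_partition
begin

text \<open>There are only countably many null cells, so their union is null. This excludes the
  points where the average takes its default value \<open>0\<close>.\<close>

lemma AE_cell_pos: "AE x in lborel. 0 < measure lborel (\<kappa> -` {\<kappa> x})"
proof -
  have "AE x in lborel. \<kappa> x = n \<longrightarrow> 0 < measure lborel (\<kappa> -` {n})" for n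
  proof (cases "measure lborel (\<kappa> -` {n}) = 0")
    case True
    then have "emeasure lborel (\<kappa> -` {n}) = 0"
      using cell_finite[of n] by (simp add: measure_eq_emeasure_eq_ennreal[symmetric] emeasure_eq_ennreal_measure less_top)
    then have "\<kappa> -` {n} \<in> null_sets lborel"
      by (simp add: null_sets_def)
    then show ?thesis
      by (rule AE_I'[of "\<kappa> -` {n}"]) auto
  next
    case False
    then show ?thesis by (simp add: zero_less_measure_iff)
  qed
  then have "AE x in lborel. \<forall>n. \<kappa> x = n \<longrightarrow> 0 < measure lborel (\<kappa> -` {n})"
    unfolding AE_all_countable by blast
  then show ?thesis by simp
qed

text \<open>Integrating \<open>z - d \<le> f \<le> z + d\<close> over the cell and dividing by its
  positive measure traps the average.\<close>

lemma cell_avg_oscillation: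
  assumes p: "1 \<le> p" and f: "Lp_mem p f" and pos: "0 < measure lborel (\<kappa> -` {n})"
    and osc: "\<And>y. \<kappa> y = n \<Longrightarrow> \<bar>f y - z\<bar> \<le> d"
  shows "\<bar>cell_avg \<kappa> f n - z\<bar> \<le> d"
proof -
  define w where "w = measure lborel (\<kappa> -` {n})"
  define h where "h = restrict_to f (\<kappa> -` {n})"
  have h: "integrable lborel h"
    using integrable_on_cell[OF p f] by (simp add: h_def)
  have const: "integrable lborel (\<lambda>x. a * indicator (\<kappa> -` {n}) x)"
    "(\<integral>x. a * indicator (\<kappa> -` {n}) x \<partial>lborel) = a * w" for a :: real
    using cell_finite by (auto simp: w_def)
  have "(z - d) * w \<le> integral\<^sup>L lborel h"
    unfolding const(2)[symmetric] using osc
    by (intro integral_mono const h) (force simp: h_def restrict_to_def indicator_def abs_le_iff)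
  moreover have "integral\<^sup>L lborel h \<le> (z + d) * w"
    unfolding const(2)[symmetric] using osc
    by (intro integral_mono const h) (force simp: h_def restrict_to_def indicator_def abs_le_iff)
  moreover have "cell_avg \<kappa> f n = integral\<^sup>L lborel h / w"
    by (simp add: cell_avg_def h_def w_def)
  ultimately have "z - d \<le> cell_avg \<kappa> f n" "cell_avg \<kappa> f n \<le> z + d"
    using pos by (simp_all add: w_def[symmetric] pos_le_divide_eq pos_divide_le_eq)
  then show ?thesis by simp
qed

text \<open>On \<open>I\<close> write \<open>f = v + S\<close> with \<open>S\<close> the finite
  combination. Contraction controls the average of \<open>v\<close>, and small oscillation of the
  \<open>F i\<close> moves \<open>S\<close> by at most \<open>n * C * d \<le> \<eta>\<close>. Thus
  the error is at most \<open>\<bar>cell_exp \<kappa> v x\<bar> + \<bar>v x\<bar> + \<eta>\<close>,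
  and each of the three terms contributes at most \<open>\<eta> powr p\<close> because
  \<open>I\<close> has measure at most \<open>1\<close>.\<close>

lemma cell_exp_approx_on:
  fixes F :: "nat \<Rightarrow> real \<Rightarrow> real"
  assumes p: "1 \<le> p" and f: "Lp_mem p f" and F: "\<And>i. i < n \<Longrightarrow> Lp_mem p (F i)"
    and I: "I \<in> sets borel" "emeasure lborel I \<le> 1"
    and cells: "\<And>x. x \<in> I \<Longrightarrow> \<kappa> -` {\<kappa> x} \<subseteq> I"
    and osc: "\<And>i x y. i < n \<Longrightarrow> x \<in> I \<Longrightarrow> \<kappa> y = \<kappa> x \<Longrightarrow> \<bar>F i y - F i x\<bar> \<le> d"
    and c: "\<And>i. i < n \<Longrightarrow> \<bar>c i\<bar> \<le> C" and C: "0 \<le> C" "real n * C * d \<le> \<eta>" and \<eta>: "0 \<le> \<eta>" 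
    and u: "Lp_norm p (restrict_to (\<lambda>x. f x - (\<Sum>i<n. c i * F i x)) I) \<le> \<eta>"
  shows "(\<integral>\<^sup>+x. ennreal (\<bar>cell_exp \<kappa> f x - f x\<bar> powr p) * indicator I x \<partial>lborel)
    \<le> ennreal (3 * 3 powr p * \<eta> powr p)"
proof -
  define S where "S = (\<lambda>x. \<Sum>i<n. c i * F i x)"
  define v where "v = restrict_to (\<lambda>x. f x - S x) I"
  have S: "Lp_mem p S" unfolding S_def using F p by (intro Lp_mem_sum) auto
  have v: "Lp_mem p v" unfolding v_def using f S I p by (intro Lp_mem_restrict_to Lp_mem_diff) auto
  note [measurable] = Lp_memD(1)[OF f] Lp_memD(1)[OF v] I(1)
  have vint: "(\<integral>\<^sup>+x. ennreal (\<bar>v x\<bar> powr p) \<partial>lborel) \<le> ennreal (\<eta> powr p)"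
    unfolding nn_integral_powr_eq[OF v] using u Lp_norm_le_iff[OF p \<eta>, of v]
    by (intro ennreal_leI) (simp add: v_def S_def)
  have pt: "ennreal (\<bar>cell_exp \<kappa> f x - f x\<bar> powr p) * indicator I x
      \<le> ennreal (3 powr p) * (ennreal (\<bar>cell_exp \<kappa> v x\<bar> powr p) + ennreal (\<bar>v x\<bar> powr p)
          + ennreal (\<eta> powr p) * indicator I x)"
    if pos: "0 < measure lborel (\<kappa> -` {\<kappa> x})" for x
  proof (cases "x \<in> I")
    case x: True
    \<comment> \<open>The cell of \<open>x\<close> lies inside \<open>I\<close>, so cutting
      \<open>v\<close> off outside \<open>I\<close> does not affect its average over this
      cell.\<close>
    have "restrict_to f (\<kappa> -` {\<kappa> x}) = restrict_to (\<lambda>y. 1 * v y + 1 * S y) (\<kappa> -` {\<kappa> x})"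
    proof
      fix y
      show "restrict_to f (\<kappa> -` {\<kappa> x}) y = restrict_to (\<lambda>y. 1 * v y + 1 * S y) (\<kappa> -` {\<kappa> x}) y"
        using cells[OF x] by (cases "\<kappa> y = \<kappa> x") (auto simp: restrict_to_def v_def)
    qed
    then have "cell_avg \<kappa> f (\<kappa> x) = cell_avg \<kappa> (\<lambda>y. 1 * v y + 1 * S y) (\<kappa> x)"
      by (simp add: cell_avg_def)
    also have "\<dots> = cell_avg \<kappa> v (\<kappa> x) + cell_avg \<kappa> S (\<kappa> x)"
      using cell_avg_linear[OF p v S, of 1 1] by simp
    finally have Ef: "cell_avg \<kappa> f (\<kappa> x) = cell_avg \<kappa> v (\<kappa> x) + cell_avg \<kappa> S (\<kappa> x)" .
    have "\<bar>cell_avg \<kappa> S (\<kappa> x) - S x\<bar> = \<bar>\<Sum>i<n. c i * (cell_avg \<kappa> (F i) (\<kappa> x) - F i x)\<bar>"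
      unfolding S_def using F by (subst cell_avg_sum[OF p]) (auto simp: sum_subtractf right_diff_distrib)
    also have "\<dots> \<le> (\<Sum>i<n. \<bar>c i * (cell_avg \<kappa> (F i) (\<kappa> x) - F i x)\<bar>)"
      by (rule sum_abs)
    also have "\<dots> \<le> (\<Sum>i<n. C * d)"
      unfolding abs_mult using c C osc x
      by (intro sum_mono mult_mono cell_avg_oscillation[OF p F pos]) auto
    finally have ES: "\<bar>cell_avg \<kappa> S (\<kappa> x) - S x\<bar> \<le> \<eta>"
      using C by simp
    have "f x = v x + S x"
      using x by (simp add: v_def restrict_to_def)
    then have "\<bar>cell_exp \<kappa> f x - f x\<bar> \<le> \<bar>cell_exp \<kappa> v x\<bar> + \<bar>v x\<bar> + \<eta>"
      using Ef ES unfolding cell_exp_def by linarith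
    then have "\<bar>cell_exp \<kappa> f x - f x\<bar> powr p \<le> (\<bar>cell_exp \<kappa> v x\<bar> + \<bar>v x\<bar> + \<eta>) powr p"
      using p by (intro powr_mono2) auto
    also have "\<dots> \<le> 3 powr p * (\<bar>cell_exp \<kappa> v x\<bar> powr p + \<bar>v x\<bar> powr p + \<eta> powr p)"
      using p \<eta> by (intro powr_add3_le) auto
    finally show ?thesis
      using x by (simp add: ennreal_leI flip: ennreal_plus ennreal_mult'')
  qed simp
  have "(\<integral>\<^sup>+x. ennreal (\<bar>cell_exp \<kappa> f x - f x\<bar> powr p) * indicator I x \<partial>lborel)
      \<le> (\<integral>\<^sup>+x. ennreal (3 powr p) * (ennreal (\<bar>cell_exp \<kappa> v x\<bar> powr p) + ennreal (\<bar>v x\<bar> powr p)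
          + ennreal (\<eta> powr p) * indicator I x) \<partial>lborel)"
    using AE_cell_pos by (intro nn_integral_mono_AE) (auto elim!: eventually_mono intro: pt)
  also have "\<dots> = ennreal (3 powr p) * ((\<integral>\<^sup>+x. ennreal (\<bar>cell_exp \<kappa> v x\<bar> powr p) \<partial>lborel)
      + (\<integral>\<^sup>+x. ennreal (\<bar>v x\<bar> powr p) \<partial>lborel) + ennreal (\<eta> powr p) * emeasure lborel I)"
    by (simp add: nn_integral_cmult nn_integral_add)
  also have "\<dots> \<le> ennreal (3 powr p) * (ennreal (\<eta> powr p) + ennreal (\<eta> powr p) + ennreal (\<eta> powr p) * 1)"
    using vint cell_exp_contraction[OF p v] I(2)
    by (intro mult_left_mono add_mono) (auto intro: order.trans)
  also have "\<dots> = ennreal (3 * 3 powr p * \<eta> powr p)"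
    by (simp flip: ennreal_plus ennreal_mult'')
  finally show ?thesis .
qed

end

section \<open>Partitions adapted to finitely many functions on each unit interval\<close>

text \<open>Encoding the integer part as a natural number enumerates the unit intervals, so that
  errors can be summed as a series over \<open>k\<close>.\<close>

definition unit_index :: "real \<Rightarrow> nat" where
  "unit_index x = int_encode \<lfloor>x\<rfloor>"

lemma unit_index_vimage:
  "unit_index -` {k} = {real_of_int (int_decode k)..<real_of_int (int_decode k) + 1}"
proof -
  have "unit_index x = k \<longleftrightarrow> real_of_int (int_decode k) \<le> x \<and> x < real_of_int (int_decode k) + 1" for x
    unfolding unit_index_def by (metis floor_eq_iff int_decode_inverse int_encode_inverse)
  then show ?thesis by (simp add: set_eq_iff)
qed

lemma unit_index_measurable [measurable]: "unit_index \<in> borel \<rightarrow>\<^sub>M count_space UNIV"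
  unfolding unit_index_def by measurable

lemma bounded_interval_unit_index: "bounded_interval (unit_index -` {k})"
  unfolding bounded_interval_def unit_index_vimage by simp

text \<open>The list grows by one entry at a time. The prefix built so far takes countably many
  values, so it may be treated as a fixed parameter when the next entry is appended.\<close>

lemma measurable_map_upt:
  fixes h :: "nat \<Rightarrow> 'a \<Rightarrow> 'b::countable"
  assumes "\<And>i. h i \<in> M \<rightarrow>\<^sub>M count_space UNIV"
  shows "(\<lambda>x. map (\<lambda>i. h i x) [0..<n]) \<in> M \<rightarrow>\<^sub>M count_space UNIV"
proof (induction n)
  case (Suc n)
  have "(\<lambda>x. (\<lambda>l y. l @ [h n y]) (map (\<lambda>i. h i x) [0..<n]) x) \<in> M \<rightarrow>\<^sub>M count_space UNIV"
    by (rule measurable_compose_countable[OF _ Suc]) (rule measurable_compose[OF assms], simp)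
  then show ?case by simp
qed simp

text \<open>A cell is determined by a unit interval and the values of finitely many of the functions
  rounded to a mesh depending on that interval.\<close>

lemma exists_fine_partition:
  fixes F :: "nat \<Rightarrow> real \<Rightarrow> real" and N :: "nat \<Rightarrow> nat" and d :: "nat \<Rightarrow> real"
  assumes F: "\<And>i. F i \<in> borel_measurable borel" and d: "\<And>k. 0 < d k"
  obtains \<kappa> where "cell_partition \<kappa>"
    "\<And>x y. \<kappa> x = \<kappa> y \<Longrightarrow> unit_index x = unit_index y"
    "\<And>i x y. i < N (unit_index x) \<Longrightarrow> \<kappa> y = \<kappa> x \<Longrightarrow> \<bar>F i y - F i x\<bar> \<le> d (unit_index x)"
proof
  define \<rho> where "\<rho> k x = map (\<lambda>i. \<lfloor>F i x / d k\<rfloor>) [0..<N k]" for k x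
  \<comment> \<open>\<open>to_nat\<close> is injective on this countable type: equal labels mean the
    same unit interval and the same rounded values.\<close>
  define \<kappa> where "\<kappa> x = to_nat (unit_index x, \<rho> (unit_index x) x)" for x
  show ui: "unit_index x = unit_index y" if "\<kappa> x = \<kappa> y" for x y
    using that by (simp add: \<kappa>_def)
  show "\<bar>F i y - F i x\<bar> \<le> d (unit_index x)" if "i < N (unit_index x)" "\<kappa> y = \<kappa> x" for i x y
  proof -
    define k where "k = unit_index x"
    have "\<rho> k y ! i = \<rho> k x ! i"
      using that ui[OF that(2)] by (simp add: \<kappa>_def k_def)
    then have "\<lfloor>F i y / d k\<rfloor> = \<lfloor>F i x / d k\<rfloor>"
      using that by (simp add: \<rho>_def k_def)
    \<comment> \<open>Numbers with equal floors differ by less than \<open>1\<close>; rescaling by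
      \<open>d k\<close> gives the oscillation bound.\<close>
    then have "\<bar>F i y / d k - F i x / d k\<bar> \<le> 1"
      by linarith
    then have "\<bar>F i y - F i x\<bar> / d k \<le> 1"
      using d[of k] by (simp add: diff_divide_distrib[symmetric])
    then show ?thesis
      using d[of k] by (simp add: k_def)
  qed
  show "cell_partition \<kappa>"
  proof
    note [measurable] = F
    have "\<rho> k \<in> borel \<rightarrow>\<^sub>M count_space UNIV" for k
      unfolding \<rho>_def by (intro measurable_map_upt) measurable
    then have "(\<lambda>x. to_nat (k, \<rho> k x)) \<in> borel \<rightarrow>\<^sub>M count_space UNIV" for k
      by (rule measurable_compose) simp
    \<comment> \<open>The unit index is itself measurable with countably many values, so it suffices
      to check the label for each fixed \<open>k\<close>.\<close>
    then show "\<kappa> \<in> borel \<rightarrow>\<^sub>M count_space UNIV"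
      unfolding \<kappa>_def by (rule measurable_compose_countable) (rule unit_index_measurable)
  next
    fix n
    show "emeasure lborel (\<kappa> -` {n}) < \<infinity>"
    proof (cases "\<kappa> -` {n} = {}")
      case False
      then obtain x where "\<kappa> x = n" by auto
      then have "\<kappa> -` {n} \<subseteq> unit_index -` {unit_index x}"
        using ui by auto
      then have "emeasure lborel (\<kappa> -` {n}) \<le> emeasure lborel (unit_index -` {unit_index x})"
        by (rule emeasure_mono) (simp add: unit_index_vimage)
      also have "\<dots> < \<infinity>"
        by (simp add: unit_index_vimage)
      finally show ?thesis .
    qed simp
  qed
qed

section \<open>The embedding into the sequence space\<close>

text \<open>Common target of both hypotheses. The coefficients \<open>c\<close> may vary with
  \<open>f\<close>, but \<open>n\<close> and \<open>C\<close> are uniform over the unit sphere,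
  because one partition, fixed before \<open>f\<close>, has to serve all of \<open>X\<close>. The
  embedding is \<open>cell_coords p \<kappa>\<close>.\<close>

lemma embeds_if_locally_finite_rank:
  fixes F :: "nat \<Rightarrow> real \<Rightarrow> real"
  assumes p: "1 \<le> p" and X: "\<And>f. f \<in> X \<Longrightarrow> Lp_mem p f" and F: "\<And>i. Lp_mem p (F i)"
    and approx: "\<And>k e. 0 < e \<Longrightarrow> \<exists>n C. \<forall>f\<in>X. Lp_norm p f = 1 \<longrightarrow>
      (\<exists>c. (\<forall>i<n. \<bar>c i\<bar> \<le> C) \<and>
        Lp_norm p (restrict_to (\<lambda>x. f x - (\<Sum>i<n. c i * F i x)) (unit_index -` {k})) \<le> e)"
  shows "embeds_almost_isometrically_lp p X"
  unfolding embeds_almost_isometrically_lp_def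
proof (intro allI impI)
  fix \<epsilon> :: real assume \<epsilon>: "0 < \<epsilon>"
  \<comment> \<open>Chosen so that \<open>1 - \<delta>\<close> is exactly the required lower bound,
    while \<open>1 + \<delta> \<le> 1 + \<epsilon>\<close>.\<close>
  define \<delta> where "\<delta> = \<epsilon> / (1 + \<epsilon>)"
  have \<delta>: "0 < \<delta>" "\<delta> \<le> \<epsilon>" "1 - \<delta> = inverse (1 + \<epsilon>)"
    using \<epsilon> by (auto simp: \<delta>_def field_simps)
  \<comment> \<open>\<open>\<theta>\<close> cancels the factor \<open>3 * 3 powr p\<close> of the
    local estimate, and \<open>\<eta> k\<close> gives the interval with index \<open>k\<close> the
    share \<open>(1 / 2) ^ Suc k\<close> of the total error; these shares sum to
    \<open>1\<close>.\<close>
  define \<theta> where "\<theta> = \<delta> powr p / (3 * 3 powr p)"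
  define \<eta> where "\<eta> k = (\<theta> * (1 / 2) ^ Suc k) powr (1 / p)" for k
  have \<theta>: "0 < \<theta>" using \<delta> by (simp add: \<theta>_def)
  have \<eta>: "0 < \<eta> k" "\<eta> k powr p = \<theta> * (1 / 2) ^ Suc k" for k
    using \<theta> p by (auto simp: \<eta>_def powr_powr)
  define good where "good k n C \<longleftrightarrow> (\<forall>f\<in>X. Lp_norm p f = 1 \<longrightarrow> (\<exists>c. (\<forall>i<n. \<bar>c i\<bar> \<le> C) \<and>
      Lp_norm p (restrict_to (\<lambda>x. f x - (\<Sum>i<n. c i * F i x)) (unit_index -` {k})) \<le> \<eta> k))" for k n and C :: real
  have "\<exists>n C. good k n C" for k
    unfolding good_def using approx[OF \<eta>(1)] by blast
  then obtain N C where NC: "\<And>k. good k (N k) (C k)"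
    by metis
  \<comment> \<open>The summand \<open>1\<close> keeps the divisor nonzero when \<open>N k\<close>
    or \<open>C k\<close> is zero; the absolute value is there because \<open>C k\<close> may be
    negative.\<close>
  define d where "d k = \<eta> k / (real (N k) * \<bar>C k\<bar> + 1)" for k
  have pos: "0 < real (N k) * \<bar>C k\<bar> + 1" for k
    by (simp add: add_nonneg_pos)
  have d: "0 < d k" "real (N k) * \<bar>C k\<bar> * d k \<le> \<eta> k" for k
    using \<eta>(1)[of k] pos[of k] by (auto simp: d_def field_simps)
  obtain \<kappa> where part: "cell_partition \<kappa>"
    and ui: "\<And>x y. \<kappa> x = \<kappa> y \<Longrightarrow> unit_index x = unit_index y"
    and osc: "\<And>i x y. i < N (unit_index x) \<Longrightarrow> \<kappa> y = \<kappa> x \<Longrightarrow> \<bar>F i y - F i x\<bar> \<le> d (unit_index x)"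
    using exists_fine_partition[of F d N] Lp_memD(1)[OF F] d(1) by metis
  interpret cell_partition \<kappa> by (rule part)
  have close: "Lp_norm p (\<lambda>x. cell_exp \<kappa> f x - f x) \<le> \<delta>" if f: "f \<in> X" "Lp_norm p f = 1" for f
  proof -
    note [measurable] = Lp_memD(1)[OF X[OF f(1)]]
    have local: "(\<integral>\<^sup>+x. ennreal (\<bar>cell_exp \<kappa> f x - f x\<bar> powr p) * indicator (unit_index -` {k}) x \<partial>lborel)
        \<le> ennreal (\<delta> powr p * (1 / 2) ^ Suc k)" for k
    proof -
      from NC[of k] f obtain c where c: "\<And>i. i < N k \<Longrightarrow> \<bar>c i\<bar> \<le> C k"
        "Lp_norm p (restrict_to (\<lambda>x. f x - (\<Sum>i<N k. c i * F i x)) (unit_index -` {k})) \<le> \<eta> k"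
        unfolding good_def by blast
      have "(\<integral>\<^sup>+x. ennreal (\<bar>cell_exp \<kappa> f x - f x\<bar> powr p) * indicator (unit_index -` {k}) x \<partial>lborel)
          \<le> ennreal (3 * 3 powr p * \<eta> k powr p)"
      proof (rule cell_exp_approx_on[OF p X[OF f(1)], where n = "N k" and F = F and c = c
            and C = "\<bar>C k\<bar>" and d = "d k"])
        show "\<bar>c i\<bar> \<le> \<bar>C k\<bar>" if "i < N k" for i
          using c(1)[OF that] by linarith
        show "\<kappa> -` {\<kappa> x} \<subseteq> unit_index -` {k}" if "x \<in> unit_index -` {k}" for x
          using that by (auto dest: ui)
        show "\<bar>F i y - F i x\<bar> \<le> d k" if "i < N k" "x \<in> unit_index -` {k}" "\<kappa> y = \<kappa> x" for i x y
          using osc[of i x y] that by simp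
        show "unit_index -` {k} \<in> sets borel" "emeasure lborel (unit_index -` {k}) \<le> 1"
          by (simp_all add: unit_index_vimage)
        show "0 \<le> \<eta> k"
          using \<eta>(1)[of k] by simp
      qed (use F c(2) d(2)[of k] in auto)
      also have "3 * 3 powr p * \<eta> k powr p = \<delta> powr p * (1 / 2) ^ Suc k"
        by (simp add: \<eta>(2) \<theta>_def)
      finally show ?thesis .
    qed
    have "(\<integral>\<^sup>+x. ennreal (\<bar>cell_exp \<kappa> f x - f x\<bar> powr p) \<partial>lborel)
        = (\<Sum>k. \<integral>\<^sup>+x. ennreal (\<bar>cell_exp \<kappa> f x - f x\<bar> powr p) * indicator (unit_index -` {k}) x \<partial>lborel)"
      by (rule nn_integral_vimage_sums) (auto simp: unit_index_vimage)
    also have "\<dots> \<le> (\<Sum>k. ennreal (\<delta> powr p * (1 / 2) ^ Suc k))"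
      using local by (intro suminf_le) auto
    also have "\<dots> = ennreal (\<delta> powr p)"
      using sums_mult[OF power_half_series, of "\<delta> powr p"]
      by (intro suminf_ennreal_eq) auto
    finally have "ennreal (\<integral>x. \<bar>cell_exp \<kappa> f x - f x\<bar> powr p \<partial>lborel) \<le> ennreal (\<delta> powr p)"
      using cell_exp_Lp_mem[OF p X[OF f(1)]] X[OF f(1)] p
      by (subst (asm) nn_integral_powr_eq) (auto intro: Lp_mem_diff)
    then show ?thesis
      using Lp_norm_le_iff[OF p] \<delta> by simp
  qed
  show "\<exists>T. (\<forall>f\<in>X. lp_seq_mem p (T f)) \<and>
      (\<forall>f\<in>X. \<forall>g\<in>X. \<forall>a b. T (\<lambda>x. a * f x + b * g x) = (\<lambda>n. a * T f n + b * T g n)) \<and>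
      (\<forall>f\<in>X. Lp_norm p f = 1 \<longrightarrow>
        inverse (1 + \<epsilon>) \<le> lp_seq_norm p (T f) \<and> lp_seq_norm p (T f) \<le> 1 + \<epsilon>)"
  proof (rule exI[of _ "cell_coords p \<kappa>"], intro conjI ballI allI impI)
    fix f assume f: "f \<in> X"
    show "lp_seq_mem p (cell_coords p \<kappa> f)"
      by (rule cell_coords_mem[OF p X[OF f]])
  next
    fix f g a b assume f: "f \<in> X" and g: "g \<in> X"
    show "cell_coords p \<kappa> (\<lambda>x. a * f x + b * g x) = (\<lambda>n. a * cell_coords p \<kappa> f n + b * cell_coords p \<kappa> g n)"
      by (rule ext) (simp add: cell_coords_def cell_avg_linear[OF p X[OF f] X[OF g]] algebra_simps)
  next
    fix f assume f: "f \<in> X" and 1: "Lp_norm p f = 1"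
    \<comment> \<open>Reverse triangle inequality between \<open>cell_exp \<kappa> f\<close> and
      \<open>f\<close>, the latter of norm \<open>1\<close>.\<close>
    have "\<bar>lp_seq_norm p (cell_coords p \<kappa> f) - 1\<bar> \<le> \<delta>"
      using Lp_norm_diff_bound[OF p cell_exp_Lp_mem[OF p X[OF f]] X[OF f]] close[OF f 1] 1
      by (simp add: cell_coords_norm[OF p X[OF f]])
    with \<delta> show "inverse (1 + \<epsilon>) \<le> lp_seq_norm p (cell_coords p \<kappa> f)"
      "lp_seq_norm p (cell_coords p \<kappa> f) \<le> 1 + \<epsilon>"
      by linarith+
  qed
qed

section \<open>Frames and minimal systems\<close>

text \<open>Any bound on the unit sphere will do. For \<open>p = 1\<close> it is an essential bound
  of \<open>g\<close>; for \<open>p > 1\<close> Young's inequality, applied pointwise, gives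
  \<open>1\<close> plus the integral of \<open>\<bar>g x\<bar> powr q\<close>.\<close>

lemma pairing_bounded:
  assumes p: "1 \<le> p" and g: "Lq_mem p g"
  shows "\<exists>K. \<forall>f. Lp_mem p f \<longrightarrow> Lp_norm p f = 1 \<longrightarrow> \<bar>pairing f g\<bar> \<le> K"
proof -
  have bound: "\<bar>pairing f g\<bar> \<le> integral\<^sup>L lborel h"
    if f: "Lp_mem p f" and [measurable]: "g \<in> borel_measurable borel"
      and h: "integrable lborel h" and le: "AE x in lborel. \<bar>f x * g x\<bar> \<le> h x" for f h
  proof -
    note [measurable] = Lp_memD(1)[OF f]
    have "AE x in lborel. norm (f x * g x) \<le> norm (h x)"
      using le by eventually_elim auto
    then have "integrable lborel (\<lambda>x. f x * g x)"
      by (intro Bochner_Integration.integrable_bound[OF h]) auto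
    then have "(\<integral>x. \<bar>f x * g x\<bar> \<partial>lborel) \<le> integral\<^sup>L lborel h"
      using h le by (intro integral_mono_AE) auto
    then show ?thesis
      using integral_norm_bound[of lborel "\<lambda>x. f x * g x"] unfolding pairing_def real_norm_def by linarith
  qed
  show ?thesis
  proof (cases "p = 1")
    case True
    with g obtain C where g: "g \<in> borel_measurable borel" "AE x in lborel. \<bar>g x\<bar> \<le> C"
      by (auto simp: Lq_mem_def)
    have "\<bar>pairing f g\<bar> \<le> C" if f: "Lp_mem p f" "Lp_norm p f = 1" for f
    proof -
      have "AE x in lborel. \<bar>f x * g x\<bar> \<le> C * (\<bar>f x\<bar> powr p)"
        using g(2)
      proof eventually_elim
        case (elim x)
        then show ?case
          using True mult_right_mono[OF elim abs_ge_zero[of "f x"]] by (simp add: abs_mult mult.commute)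
      qed
      then have "\<bar>pairing f g\<bar> \<le> (\<integral>x. C * (\<bar>f x\<bar> powr p) \<partial>lborel)"
        using Lp_memD(2)[OF f(1)] by (intro bound[OF f(1) g(1)]) auto
      then show ?thesis
        using f(2) Lp_norm_eq_1_iff[OF p] by simp
    qed
    then show ?thesis by blast
  next
    case False
    define q where "q = p / (p - 1)"
    have pq: "p > 1" "q > 1" "1 / p + 1 / q = 1"
      using False p by (auto simp: q_def field_simps)
    have gq: "Lp_mem q g"
      using g False by (simp add: Lq_mem_def q_def)
    have "\<bar>pairing f g\<bar> \<le> 1 + (\<integral>x. \<bar>g x\<bar> powr q \<partial>lborel)" if f: "Lp_mem p f" "Lp_norm p f = 1" for f
    proof -
      have "\<bar>f x * g x\<bar> \<le> \<bar>f x\<bar> powr p + \<bar>g x\<bar> powr q" for x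
      proof -
        have "\<bar>f x\<bar> * \<bar>g x\<bar> \<le> \<bar>f x\<bar> powr p / p + \<bar>g x\<bar> powr q / q"
          using pq by (intro Youngs_inequality) auto
        also have "\<dots> \<le> \<bar>f x\<bar> powr p + \<bar>g x\<bar> powr q"
          using pq by (intro add_mono divide_le_eq_1_pos[THEN iffD2] mult_imp_div_pos_le)
             (auto simp: mult_le_cancel_left1)
        finally show ?thesis by (simp add: abs_mult)
      qed
      then have "\<bar>pairing f g\<bar> \<le> (\<integral>x. \<bar>f x\<bar> powr p + \<bar>g x\<bar> powr q \<partial>lborel)"
        using Lp_memD(2)[OF f(1)] Lp_memD(2)[OF gq] by (intro bound[OF f(1) Lp_memD(1)[OF gq]]) auto
      then show ?thesis
        using f Lp_memD(2)[OF f(1)] Lp_memD(2)[OF gq] Lp_norm_eq_1_iff[OF p] by simp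
    qed
    then show ?thesis by blast
  qed
qed

lemma Lp_norm_restrict_to_le:
  assumes p: "1 \<le> p" and f: "Lp_mem p f" and I: "I \<in> sets borel"
  shows "Lp_norm p (restrict_to f I) \<le> Lp_norm p f"
proof -
  have "(\<integral>x. \<bar>restrict_to f I x\<bar> powr p \<partial>lborel) \<le> (\<integral>x. \<bar>f x\<bar> powr p \<partial>lborel)"
    using Lp_mem_restrict_to[OF f I] p f
    by (intro integral_mono Lp_memD(2)) (auto simp: restrict_to_def indicator_def)
  then show ?thesis
    using Lp_norm_le_iff[OF p Lp_norm_nonneg[of p f], of "restrict_to f I"] Lp_norm_powr[OF p, of f] by simp
qed

lemma subspace_sum:
  fixes F :: "nat \<Rightarrow> real \<Rightarrow> real"
  assumes X: "closed_Lp_subspace p X" and F: "\<And>i. F i \<in> X"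
  shows "(\<lambda>x. \<Sum>i<m. a i * F i x) \<in> X"
proof (induction m)
  case 0
  then show ?case using X by (simp add: closed_Lp_subspace_def)
next
  case (Suc m)
  have "\<forall>f\<in>X. \<forall>g\<in>X. \<forall>a b. (\<lambda>x. a * f x + b * g x) \<in> X"
    using X unfolding closed_Lp_subspace_def by (elim conjE)
  from this[rule_format, OF Suc F[of m], of 1 "a m"] show ?case by simp
qed

lemma linear_functional_sum:
  fixes F :: "nat \<Rightarrow> real \<Rightarrow> real" and \<phi> :: "(real \<Rightarrow> real) \<Rightarrow> real"
  assumes X: "closed_Lp_subspace p X" and F: "\<And>i. F i \<in> X"
    and \<phi>: "\<And>f g a b. f \<in> X \<Longrightarrow> g \<in> X \<Longrightarrow> \<phi> (\<lambda>x. a * f x + b * g x) = a * \<phi> f + b * \<phi> g"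
  shows "\<phi> (\<lambda>x. \<Sum>i<m. a i * F i x) = (\<Sum>i<m. a i * \<phi> (F i))"
proof (induction m)
  case 0
  \<comment> \<open>The zero function is the combination of \<open>F\<close> terms with both
    coefficients \<open>0\<close>.\<close>
  then show ?case using \<phi>[OF F F, of 0 0 0 0] by simp
next
  case (Suc m)
  have "\<phi> (\<lambda>x. 1 * (\<Sum>i<m. a i * F i x) + a m * F m x) = 1 * \<phi> (\<lambda>x. \<Sum>i<m. a i * F i x) + a m * \<phi> (F m)"
    by (rule \<phi>[OF subspace_sum[OF X F] F])
  with Suc show ?case by simp
qed

text \<open>Rescaling an approximant of \<open>f\<close> to norm one at most doubles the error
  bound. Zero coefficients pad it beyond length \<open>n\<close>, so that the block from
  \<open>n\<close> on is nonempty, as \<open>cond_star_star\<close> demands.\<close>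

lemma normalized_combination:
  fixes F :: "nat \<Rightarrow> real \<Rightarrow> real"
  assumes p: "1 \<le> p" and X: "closed_Lp_subspace p X" and fund: "fundamental p X F"
    and f: "f \<in> X" "Lp_norm p f = 1" and e: "0 < e"
  obtains m a where "n < m" "Lp_norm p (\<lambda>x. \<Sum>i<m. a i * F i x) = 1"
    "Lp_norm p (\<lambda>x. f x - (\<Sum>i<m. a i * F i x)) \<le> e"
proof -
  have mem: "Lp_mem p h" if "h \<in> X" for h
    using X that by (simp add: closed_Lp_subspace_def)
  have F: "F i \<in> X" for i using fund by (simp add: fundamental_def)
  \<comment> \<open>The bound \<open>1 / 2\<close> keeps the norm \<open>s\<close> of the
    approximant positive; \<open>e / 2\<close> leaves room for the rescaling error.\<close>
  define \<eta> where "\<eta> = min (1 / 2) (e / 2)"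
  have \<eta>: "0 < \<eta>" "\<eta> \<le> 1 / 2" "2 * \<eta> \<le> e" using e by (auto simp: \<eta>_def)
  obtain l b where lb: "Lp_norm p (\<lambda>x. f x - (\<Sum>i<l. b i * F i x)) < \<eta>"
    using fund f(1) \<eta>(1) unfolding fundamental_def by blast
  define g where "g = (\<lambda>x. \<Sum>i<l. b i * F i x)"
  define s where "s = Lp_norm p g"
  define m where "m = max l (Suc n)"
  define a where "a i = (if i < l then b i / s else 0)" for i
  have g: "Lp_mem p g" "Lp_mem p f"
    using mem subspace_sum[OF X F] f(1) by (auto simp: g_def)
  have fg: "Lp_norm p (\<lambda>x. f x - g x) < \<eta>" using lb by (simp add: g_def)
  have s: "\<bar>s - 1\<bar> < \<eta>"
    using Lp_norm_diff_bound[OF p g(2) g(1)] fg f(2) by (simp add: s_def)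
  then have s0: "0 < s" using \<eta> by linarith
  have sum: "(\<Sum>i<m. a i * F i x) = inverse s * g x" for x
  proof -
    have "(\<Sum>i<m. a i * F i x) = (\<Sum>i<l. a i * F i x)"
      by (intro sum.mono_neutral_right) (auto simp: m_def a_def)
    also have "\<dots> = (\<Sum>i<l. inverse s * (b i * F i x))"
      by (intro sum.cong) (auto simp: a_def divide_inverse)
    finally show ?thesis by (simp add: g_def sum_distrib_left)
  qed
  have "Lp_norm p (\<lambda>x. \<Sum>i<m. a i * F i x) = 1"
    unfolding sum using s0 by (simp add: Lp_norm_scale[OF p] s_def)
  moreover have "Lp_norm p (\<lambda>x. f x - (\<Sum>i<m. a i * F i x)) \<le> e"
  proof -
    \<comment> \<open>The second summand is the rescaling error; its norm is
      \<open>\<bar>s - 1\<bar>\<close>, which the reverse triangle inequality bounds by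
      \<open>\<eta>\<close>.\<close>
    have "(\<lambda>x. f x - (\<Sum>i<m. a i * F i x)) = (\<lambda>x. (f x - g x) + (1 - inverse s) * g x)"
      by (simp add: sum algebra_simps)
    then have "Lp_norm p (\<lambda>x. f x - (\<Sum>i<m. a i * F i x))
        \<le> Lp_norm p (\<lambda>x. f x - g x) + Lp_norm p (\<lambda>x. (1 - inverse s) * g x)"
      using Lp_norm_triangle[OF p Lp_mem_diff[OF g(2,1)] Lp_mem_scale[OF g(1)]] p by simp
    also have "Lp_norm p (\<lambda>x. (1 - inverse s) * g x) = \<bar>1 - inverse s\<bar> * \<bar>s\<bar>"
      using s0 by (simp add: Lp_norm_scale[OF p] s_def)
    also have "\<dots> = \<bar>s - 1\<bar>"
    proof -
      have "(1 - inverse s) * s = s - 1"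
        using s0 by (simp add: left_diff_distrib)
      then show ?thesis by (simp only: abs_mult[symmetric])
    qed
    finally show ?thesis using fg s \<eta> by linarith
  qed
  ultimately show ?thesis by (intro that[of m a]) (auto simp: m_def)
qed

theorem theorem2p4:
  fixes p :: real and X :: "(real \<Rightarrow> real) set"
  assumes "1 \<le> p"
    and "closed_Lp_subspace p X"
    and "(\<exists>F G. is_frame p X F G \<and> cond_star p X F G) \<or>
         (\<exists>F. semi_normalized p F \<and> bounded_minimal_system p X F \<and>
              fundamental p X F \<and> cond_star_star p F)"
  shows "embeds_almost_isometrically_lp p X"
  using assms(3)
proof (elim disjE exE conjE)
  note p = assms(1)
  have X: "Lp_mem p f" if "f \<in> X" for f
    using assms(2) that by (simp add: closed_Lp_subspace_def)
  \<comment> \<open>In the frame case the frame coefficients of \<open>f\<close> themselves serve as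
    \<open>c\<close>.\<close>
  fix F G assume frame: "is_frame p X F G" and star: "cond_star p X F G"
  have F: "Lp_mem p (F i)" for i
    using frame X by (simp add: is_frame_def)
  have "\<exists>K. \<forall>f. Lp_mem p f \<longrightarrow> Lp_norm p f = 1 \<longrightarrow> \<bar>pairing f (G i)\<bar> \<le> K" for i
    using frame by (intro pairing_bounded p) (simp add: is_frame_def)
  then obtain K where K: "\<And>i f. Lp_mem p f \<Longrightarrow> Lp_norm p f = 1 \<Longrightarrow> \<bar>pairing f (G i)\<bar> \<le> K i"
    by metis
  show ?thesis
  proof (rule embeds_if_locally_finite_rank[OF p X F])
    fix k and e :: real assume "0 < e"
    then obtain n where n: "\<And>f. f \<in> X \<Longrightarrow>
        Lp_norm p (restrict_to (\<lambda>x. f x - (\<Sum>i<n. pairing f (G i) * F i x)) (unit_index -` {k})) \<le> e * Lp_norm p f"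
      using star bounded_interval_unit_index[of k] unfolding cond_star_def by blast
    \<comment> \<open>A sum of absolute values gives one bound for all \<open>i < n\<close>.\<close>
    have "\<bar>pairing f (G i)\<bar> \<le> (\<Sum>i<n. \<bar>K i\<bar>)" if "f \<in> X" "Lp_norm p f = 1" "i < n" for f i
      using K[OF X[OF that(1)] that(2), of i] member_le_sum[of i "{..<n}" "\<lambda>i. \<bar>K i\<bar>"] that(3) by simp
    then show "\<exists>n C. \<forall>f\<in>X. Lp_norm p f = 1 \<longrightarrow> (\<exists>c. (\<forall>i<n. \<bar>c i\<bar> \<le> C) \<and>
        Lp_norm p (restrict_to (\<lambda>x. f x - (\<Sum>i<n. c i * F i x)) (unit_index -` {k})) \<le> e)"
      using n
      by (intro exI[of _ n] exI[of _ "\<Sum>i<n. \<bar>K i\<bar>"] ballI impI, rule_tac x = "\<lambda>i. pairing f (G i)" in exI)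
         fastforce
  qed
next
  note p = assms(1)
  have X: "Lp_mem p f" if "f \<in> X" for f
    using assms(2) that by (simp add: closed_Lp_subspace_def)
  fix F assume sn: "semi_normalized p F" and bms: "bounded_minimal_system p X F"
    and fund: "fundamental p X F" and star: "cond_star_star p F"
  have FX: "F i \<in> X" for i
    using fund by (simp add: fundamental_def)
  have F: "Lp_mem p (F i)" for i
    using FX X by simp
  obtain c0 where c0: "0 < c0" "\<And>i. c0 \<le> Lp_norm p (F i)"
    using sn unfolding semi_normalized_def by metis
  obtain \<phi> where \<phi>: "\<forall>i. \<forall>f\<in>X. \<forall>g\<in>X. \<forall>a b. \<phi> i (\<lambda>x. a * f x + b * g x) = a * \<phi> i f + b * \<phi> i g"
    and \<phi>F: "\<forall>i j. \<phi> i (F j) = (if i = j then 1 else 0)"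
    and "\<exists>M. \<forall>i. \<forall>f\<in>X. Lp_norm p (F i) * \<bar>\<phi> i f\<bar> \<le> M * Lp_norm p f"
    using bms unfolding bounded_minimal_system_def by (elim conjE exE) (rule that, auto)
  then obtain M where M: "\<And>i f. f \<in> X \<Longrightarrow> Lp_norm p (F i) * \<bar>\<phi> i f\<bar> \<le> M * Lp_norm p f"
    by blast
  \<comment> \<open>The functional \<open>\<phi> i\<close> extracts the coefficient
    \<open>a i\<close>, and the lower bound \<open>c0\<close> on the norms turns the bound
    \<open>M\<close> on the products into a bound independent of \<open>i\<close>, \<open>m\<close>
    and \<open>a\<close>.\<close>
  have coeff: "\<bar>a i\<bar> \<le> M / c0" if "Lp_norm p (\<lambda>x. \<Sum>i<m. a i * F i x) = 1" "i < m" for a i m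
  proof -
    have "\<phi> i (\<lambda>x. \<Sum>i<m. a i * F i x) = (\<Sum>j<m. a j * \<phi> i (F j))"
      using \<phi> by (intro linear_functional_sum[OF assms(2) FX]) simp
    also have "\<dots> = a i"
      using that(2) by (simp add: \<phi>F if_distrib cong: if_cong)
    finally have "c0 * \<bar>a i\<bar> \<le> Lp_norm p (F i) * \<bar>\<phi> i (\<lambda>x. \<Sum>i<m. a i * F i x)\<bar>"
      using c0 by (simp add: mult_right_mono)
    also have "\<dots> \<le> M"
      using M[OF subspace_sum[OF assms(2), of F, OF FX, where a = a and m = m], of i] that(1) by simp
    finally show ?thesis
      using c0 by (simp add: pos_le_divide_eq mult.commute)
  qed
  show ?thesis
  proof (rule embeds_if_locally_finite_rank[OF p X F])
    fix k and e :: real assume e: "0 < e"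
    define I where "I = unit_index -` {k}"
    have I: "I \<in> sets borel" by (simp add: I_def unit_index_vimage)
    have "0 < e / 2" "bounded_interval I"
      using e by (simp_all add: I_def bounded_interval_unit_index)
    then obtain n where n: "\<And>k m1 m2 a. n \<le> k \<Longrightarrow> k < m1 \<Longrightarrow> m1 \<le> m2 \<Longrightarrow>
        Lp_norm p (\<lambda>x. \<Sum>i<m2. a i * F i x) = 1 \<Longrightarrow>
        Lp_norm p (restrict_to (\<lambda>x. \<Sum>i\<in>{k..<m1}. a i * F i x) I) \<le> e / 2"
      using star unfolding cond_star_star_def by meson
    have "\<exists>c. (\<forall>i<n. \<bar>c i\<bar> \<le> M / c0) \<and>
        Lp_norm p (restrict_to (\<lambda>x. f x - (\<Sum>i<n. c i * F i x)) I) \<le> e"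
      if f: "f \<in> X" "Lp_norm p f = 1" for f
    proof -
      obtain m a where ma: "n < m" "Lp_norm p (\<lambda>x. \<Sum>i<m. a i * F i x) = 1"
        "Lp_norm p (\<lambda>x. f x - (\<Sum>i<m. a i * F i x)) \<le> e / 2"
        using normalized_combination[OF p assms(2) fund f, of "e / 2" n] e by auto
      define u where "u = (\<lambda>x. f x - (\<Sum>i<m. a i * F i x))"
      define v where "v = (\<lambda>x. \<Sum>i\<in>{n..<m}. a i * F i x)"
      have uv: "Lp_mem p u" "Lp_mem p v"
        using p F X[OF f(1)] unfolding u_def v_def by (auto intro!: Lp_mem_diff Lp_mem_sum)
      \<comment> \<open>Hence \<open>f\<close> minus the first \<open>n\<close> terms is
        \<open>u + v\<close>: the approximation error of the whole combination plus the block of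
        terms from \<open>n\<close> to \<open>m - 1\<close>.\<close>
      have split: "(\<Sum>i<m. a i * F i x) = (\<Sum>i<n. a i * F i x) + v x" for x
        unfolding v_def lessThan_atLeast0 using ma(1) by (simp add: sum.atLeastLessThan_concat)
      have "restrict_to (\<lambda>x. f x - (\<Sum>i<n. a i * F i x)) I
          = (\<lambda>x. restrict_to u I x + restrict_to v I x)"
        by (simp add: restrict_to_def u_def split distrib_left[symmetric])
      then have "Lp_norm p (restrict_to (\<lambda>x. f x - (\<Sum>i<n. a i * F i x)) I)
          \<le> Lp_norm p (restrict_to u I) + Lp_norm p (restrict_to v I)"
        using Lp_norm_triangle[OF p Lp_mem_restrict_to[OF uv(1) I] Lp_mem_restrict_to[OF uv(2) I]] p by simp
      \<comment> \<open>Restriction does not increase the norm of \<open>u\<close>; for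
        \<open>v\<close> the tail condition is used with the block starting at \<open>n\<close> and
        ending with the whole combination.\<close>
      also have "\<dots> \<le> e / 2 + e / 2"
        using Lp_norm_restrict_to_le[OF p uv(1) I] ma(3) n[OF order.refl ma(1) order.refl ma(2)]
        by (simp add: u_def v_def)
      finally show ?thesis
        using coeff[OF ma(2)] ma(1) by (intro exI[of _ a]) auto
    qed
    then show "\<exists>n C. \<forall>f\<in>X. Lp_norm p f = 1 \<longrightarrow> (\<exists>c. (\<forall>i<n. \<bar>c i\<bar> \<le> C) \<and>
        Lp_norm p (restrict_to (\<lambda>x. f x - (\<Sum>i<n. c i * F i x)) (unit_index -` {k})) \<le> e)"
      unfolding I_def by blast
  qed
qed

end
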